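(* Let $(\mathcal{Z},\mathfrak{Z})$ be a measurable space, $P$ a probability measure on it, $\alpha>0$, and let $\ell:\mathcal{Z}\to(-\infty,\infty]$ be measurable, $\ell\in\mathcal{L}^1(P)$, and bounded below $P$-almost surely. Let $f(t)=(\sqrt t-1)^2$ for $t\ge 0$. Suppose there is $\lambda^\star\in\mathbb{R}$ such that $\alpha+\ell+\lambda^\star>0$ $P$-a.s. and $$\int_{\mathcal{Z}}\left(\frac{\alpha}{\alpha+\ell+\lambda^\star}\right)^2\mathrm{d}P=1.$$ Then the unique minimizer over all probability measures $Q$ on $(\mathcal{Z},\mathfrak{Z})$ of $$\int_{\mathcal{Z}}\ell\,\mathrm{d}Q+\alpha\,\mathsf{D}_f(Q\Vert P)$$ is the probability measure $Q^\star$ given by $$\frac{\mathrm{d}Q^\star}{\mathrm{d}P}(z)=\left(\frac{\alpha}{\alpha+\ell(z)+\lambda^\star}\right)^2\quad\text{for }P\text{-a.e. }z.$$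
   Context: $\mathsf{D}_f(Q\Vert P)=\int_{\mathcal{Z}}f(\mathrm{d}Q/\mathrm{d}P)\,\mathrm{d}P$ if $Q\ll P$, and $\mathsf{D}_f(Q\Vert P)=\infty$ otherwise (here $f$ is the squared-Hellinger generator). Integrals are extended integrals in $(-\infty,\infty]$, defined whenever the negative part of the integrand has finite integral. *)

theory Defs
  imports "HOL-Probability.Probability"
begin

text \<open>Extended integral of an extended-real-valued function. It is meaningful only if the
  negative part of the integrand has finite integral (note that \<open>e2ennreal\<close> truncates
  negative values to \<open>0\<close>).\<close>

definition ext_integral :: "'a measure \<Rightarrow> ('a \<Rightarrow> ereal) \<Rightarrow> ereal" where
  "ext_integral M g =
     enn2ereal (\<integral>\<^sup>+ z. e2ennreal (g z) \<partial>M) - enn2ereal (\<integral>\<^sup>+ z. e2ennreal (- g z) \<partial>M)"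

text \<open>\<open>f_divergence f Q P\<close> is $D_f(Q \Vert P)$; \<open>absolutely_continuous P Q\<close> is the library's
  rendering of $Q \ll P$. For probability measures \<open>RN_deriv P Q\<close> is finite \<open>P\<close>-almost
  everywhere, so passing to \<open>enn2real\<close> only affects a null set.\<close>

definition f_divergence :: "(real \<Rightarrow> real) \<Rightarrow> 'a measure \<Rightarrow> 'a measure \<Rightarrow> ereal" where
  "f_divergence f Q P =
     (if absolutely_continuous P Q
      then ext_integral P (\<lambda>z. ereal (f (enn2real (RN_deriv P Q z))))
      else \<infinity>)"

definition sq_hellinger :: "real \<Rightarrow> real" where
  "sq_hellinger t = (sqrt t - 1)\<^sup>2"

definition prob_measures_on :: "'a measure \<Rightarrow> 'a measure set" where
  "prob_measures_on M = {Q. prob_space Q \<and> sets Q = sets M}"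

text \<open>If \<open>Q\<close> is not absolutely continuous with respect to \<open>P\<close>, the integral of \<open>l\<close> against \<open>Q\<close>
  need not be defined; the objective is \<open>\<infinity>\<close> in that case whatever \<open>ext_integral Q l\<close> is,
  because \<open>x + \<infinity> = \<infinity>\<close> for every extended real \<open>x\<close>. If \<open>Q\<close> is absolutely continuous, a function
  \<open>l\<close> bounded below \<open>P\<close>-almost surely is so \<open>Q\<close>-almost surely, and its integral is defined.\<close>

definition penalized_objective ::
    "(real \<Rightarrow> real) \<Rightarrow> real \<Rightarrow> ('a \<Rightarrow> ereal) \<Rightarrow> 'a measure \<Rightarrow> 'a measure \<Rightarrow> ereal" where
  "penalized_objective f \<alpha> l P Q = ext_integral Q l + ereal \<alpha> * f_divergence f Q P"

lemma penalized_objective_not_ac: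
  assumes "\<alpha> > 0" "\<not> absolutely_continuous P Q"
  shows "penalized_objective f \<alpha> l P Q = \<infinity>"
  using assms by (simp add: penalized_objective_def f_divergence_def)

end

theory Submission
  imports Defs
begin

text \<open>Write \<open>s = \<alpha> + l + \<lambda>\<close> and \<open>r = \<alpha> / s\<close>. Completing the square,
  \<open>l g + \<alpha> (sqrt g - 1)\<^sup>2 + \<lambda> g = s (sqrt g - r)\<^sup>2 + \<alpha> - \<alpha>\<^sup>2 / s\<close>, where the last two terms do not
  depend on the density \<open>g\<close>. Since \<open>g\<close> and \<open>r\<^sup>2\<close> both integrate to \<open>1\<close>, integration shows that
  the objective at \<open>g\<close> exceeds its value at \<open>r\<^sup>2\<close> by \<open>\<integral> s (sqrt g - r)\<^sup>2 dP\<close>.\<close>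

section \<open>Extended integrals and Bochner integrals\<close>

lemma ext_integral_eq_integral:
  assumes u: "integrable M u" and eq: "AE z in M. g z = ereal (u z)"
  shows "ext_integral M g = ereal (\<integral>z. u z \<partial>M)"
proof -
  have fin: "(\<integral>\<^sup>+ z. ennreal (u z) \<partial>M) < top" "(\<integral>\<^sup>+ z. ennreal (- u z) \<partial>M) < top"
    using u by (auto simp: real_integrable_def less_top)
  have "(\<integral>\<^sup>+ z. e2ennreal (g z) \<partial>M) = (\<integral>\<^sup>+ z. ennreal (u z) \<partial>M)"
    "(\<integral>\<^sup>+ z. e2ennreal (- g z) \<partial>M) = (\<integral>\<^sup>+ z. ennreal (- u z) \<partial>M)"
    by (rule nn_integral_cong_AE, use eq in eventually_elim, simp)+
  moreover have "enn2ereal x = ereal (enn2real x)" if "x < top" for x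
    using that by (cases x) auto
  ultimately show ?thesis
    using fin u by (simp add: ext_integral_def real_lebesgue_integral_def)
qed

text \<open>On a finite measure the lower bound makes the integral of the negative part finite, so
  an infinite positive part would make the value \<open>\<infinity>\<close>. Hence both parts are
  finite. This turns a finite objective value into genuine integrability of the loss.\<close>

lemma ext_integral_finiteD:
  assumes "finite_measure M" and g: "g \<in> borel_measurable M"
    and b: "AE z in M. ereal b \<le> g z" and ne: "ext_integral M g \<noteq> \<infinity>"
  shows "integrable M (\<lambda>z. real_of_ereal (g z))"
    and "AE z in M. g z = ereal (real_of_ereal (g z))"
proof -
  interpret finite_measure M by fact
  have "(\<integral>\<^sup>+ z. e2ennreal (- g z) \<partial>M) \<le> (\<integral>\<^sup>+ z. ennreal (- b) \<partial>M)"
  proof (rule nn_integral_mono_AE, use b in eventually_elim)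
    case (elim z)
    then have "- g z \<le> ereal (- b)" by (cases "g z") auto
    then show ?case using e2ennreal_mono by fastforce
  qed
  also have "\<dots> < top"
    using emeasure_finite[of "space M"] by (simp add: ennreal_mult_eq_top_iff less_top[symmetric])
  finally have neg: "(\<integral>\<^sup>+ z. e2ennreal (- g z) \<partial>M) < top" .
  have pos: "(\<integral>\<^sup>+ z. e2ennreal (g z) \<partial>M) \<noteq> top"
  proof
    assume "(\<integral>\<^sup>+ z. e2ennreal (g z) \<partial>M) = top"
    with neg ne show False
      by (cases "\<integral>\<^sup>+ z. e2ennreal (- g z) \<partial>M") (auto simp: ext_integral_def)
  qed
  \<comment> \<open>The finite positive part excludes \<open>\<infinity>\<close> almost everywhere,
    and the lower bound excludes \<open>-\<infinity>\<close>.\<close>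
  have "AE z in M. e2ennreal (g z) \<noteq> \<infinity>"
    by (rule nn_integral_PInf_AE) (use g pos in auto)
  with b show eq: "AE z in M. g z = ereal (real_of_ereal (g z))"
  proof eventually_elim
    case (elim z)
    then show ?case by (cases "g z") auto
  qed
  have "(\<integral>\<^sup>+ z. ennreal (real_of_ereal (g z)) \<partial>M) = (\<integral>\<^sup>+ z. e2ennreal (g z) \<partial>M)"
    "(\<integral>\<^sup>+ z. ennreal (- real_of_ereal (g z)) \<partial>M) = (\<integral>\<^sup>+ z. e2ennreal (- g z) \<partial>M)"
    by (rule nn_integral_cong_AE, use eq in eventually_elim,
        metis e2ennreal_ereal uminus_ereal.simps(1))+
  then show "integrable M (\<lambda>z. real_of_ereal (g z))"
    using g pos neg by (simp add: real_integrable_def)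
qed

section \<open>The squared-Hellinger objective on densities\<close>

lemma integrable_sqrt:
  fixes g :: "'a \<Rightarrow> real"
  assumes "finite_measure M" and g: "integrable M g" "\<And>z. g z \<ge> 0"
  shows "integrable M (\<lambda>z. sqrt (g z))"
proof (rule Bochner_Integration.integrable_bound)
  interpret finite_measure M by fact
  \<comment> \<open>The dominating function works because \<open>x \<le> (1 + x)\<^sup>2\<close> for
    \<open>x \<ge> 0\<close>, and constants are integrable for a finite measure.\<close>
  show "integrable M (\<lambda>z. 1 + g z)" using g by simp
  have "sqrt x \<le> 1 + x" if "x \<ge> 0" for x :: real
    using that by (intro real_le_lsqrt) (auto simp: power2_eq_square algebra_simps)
  then show "AE z in M. norm (sqrt (g z)) \<le> norm (1 + g z)"
    using g(2) by simp
qed (use g in simp)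

lemma integrable_sq_hellinger:
  fixes g :: "'a \<Rightarrow> real"
  assumes "finite_measure M" and g: "integrable M g" "\<And>z. g z \<ge> 0"
  shows "integrable M (\<lambda>z. sq_hellinger (g z))"
proof -
  interpret finite_measure M by fact
  have "(\<lambda>z. sq_hellinger (g z)) = (\<lambda>z. g z - 2 * sqrt (g z) + 1)"
    using g(2) by (simp add: sq_hellinger_def power2_eq_square algebra_simps fun_eq_iff)
  then show ?thesis
    using g integrable_sqrt[OF assms] by simp
qed

text \<open>\<open>P\<close>-null sets are null for the density measure, so \<open>l\<close> may be
  replaced by \<open>L\<close> there, and \<open>g\<close> is a version of the Radon-Nikodym
  derivative by its uniqueness. Both terms then become Bochner integrals, on which linearity is
  available.\<close>

lemma penalized_objective_density:
  fixes g L :: "'a \<Rightarrow> real"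
  assumes "finite_measure P" and L: "L \<in> borel_measurable P" "AE z in P. l z = ereal (L z)"
    and g: "integrable P g" "\<And>z. g z \<ge> 0" and gL: "integrable P (\<lambda>z. g z * L z)"
  shows "penalized_objective sq_hellinger \<alpha> l P (density P (\<lambda>z. ennreal (g z)))
    = ereal ((\<integral>z. g z * L z \<partial>P) + \<alpha> * (\<integral>z. sq_hellinger (g z) \<partial>P))"
proof -
  interpret finite_measure P by fact
  let ?Q = "density P (\<lambda>z. ennreal (g z))"
  have gm[measurable]: "g \<in> borel_measurable P" using g by auto
  note L(1)[measurable]
  have ac: "absolutely_continuous P ?Q"
    by (rule absolutely_continuousI_density) simp
  have "AE z in ?Q. l z = ereal (L z)"
    using L(2) by (auto simp: AE_density)
  then have 1: "ext_integral ?Q l = ereal (\<integral>z. g z * L z \<partial>P)"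
    using ext_integral_eq_integral[of ?Q L l] gL g(2)
    by (simp add: integrable_density integral_density)
  have "AE z in P. ennreal (g z) = RN_deriv P ?Q z"
    by (rule RN_deriv_unique) simp_all
  then have "AE z in P. ereal (sq_hellinger (enn2real (RN_deriv P ?Q z))) = ereal (sq_hellinger (g z))"
    by eventually_elim (metis enn2real_ennreal g(2))
  then have 2: "f_divergence sq_hellinger ?Q P = ereal (\<integral>z. sq_hellinger (g z) \<partial>P)"
    using ac ext_integral_eq_integral[OF integrable_sq_hellinger[OF assms(1) g]]
    by (simp add: f_divergence_def)
  show ?thesis by (simp add: penalized_objective_def 1 2)
qed

text \<open>In the variable \<open>sqrt x\<close> the left side is a quadratic with leading
  coefficient \<open>\<alpha> + L + lam\<close>. The term \<open>lam * x\<close> acts as a Lagrange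
  term for the total mass.\<close>

lemma sq_hellinger_complete_square:
  fixes x \<alpha> L lam :: real
  assumes "\<alpha> + L + lam > 0" "x \<ge> 0"
  shows "x * L + \<alpha> * sq_hellinger x + lam * x
    = (\<alpha> + L + lam) * (sqrt x - \<alpha> / (\<alpha> + L + lam))\<^sup>2 + \<alpha> - \<alpha>\<^sup>2 / (\<alpha> + L + lam)"
proof -
  define s where "s = \<alpha> + L + lam"
  define y where "y = sqrt x"
  have "s \<noteq> 0" and x: "x = y\<^sup>2" and L: "L = s - \<alpha> - lam"
    using assms by (auto simp: s_def y_def)
  then have "x * L + \<alpha> * (y - 1)\<^sup>2 + lam * x = s * (y - \<alpha> / s)\<^sup>2 + \<alpha> - \<alpha>\<^sup>2 / s"
    unfolding x L by (simp add: power2_eq_square field_simps)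
  then show ?thesis by (simp add: s_def y_def sq_hellinger_def)
qed

text \<open>The completed square is used at \<open>g\<close> and at \<open>G\<close> and subtracted
  pointwise: the remainders cancel, and the square vanishes at \<open>G\<close>. Integrating the
  difference \<open>?h\<close> gives the gap, and integrability of the square is inherited from
  \<open>?h\<close>.\<close>

lemma sq_hellinger_density_gap:
  fixes g L :: "'a \<Rightarrow> real" and \<alpha> lam :: real
  defines "s \<equiv> \<lambda>z. \<alpha> + L z + lam"
  defines "G \<equiv> \<lambda>z. (\<alpha> / s z)\<^sup>2"
  assumes "finite_measure P" and "\<alpha> > 0" and L[measurable]: "L \<in> borel_measurable P"
    and s: "AE z in P. s z > 0"
    and G: "integrable P G" "integrable P (\<lambda>z. G z * L z)"
    and g: "integrable P g" "\<And>z. g z \<ge> 0" "integrable P (\<lambda>z. g z * L z)"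
    and mass: "(\<integral>z. g z \<partial>P) = (\<integral>z. G z \<partial>P)"
  shows "integrable P (\<lambda>z. s z * (sqrt (g z) - \<alpha> / s z)\<^sup>2)" (is "integrable P ?d")
    and "(\<integral>z. g z * L z \<partial>P) + \<alpha> * (\<integral>z. sq_hellinger (g z) \<partial>P)
      = (\<integral>z. G z * L z \<partial>P) + \<alpha> * (\<integral>z. sq_hellinger (G z) \<partial>P)
        + (\<integral>z. s z * (sqrt (g z) - \<alpha> / s z)\<^sup>2 \<partial>P)"
proof -
  let ?h = "\<lambda>z. (g z * L z + \<alpha> * sq_hellinger (g z) + lam * g z)
    - (G z * L z + \<alpha> * sq_hellinger (G z) + lam * G z)"
  have G0: "G z \<ge> 0" for z by (simp add: G_def)
  note int = integrable_sq_hellinger[OF assms(3) g(1,2)]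
    integrable_sq_hellinger[OF assms(3) G(1) G0] g(1,3) G
  have h: "integrable P ?h" using int by simp
  have eq: "AE z in P. ?h z = ?d z"
    using s
  proof eventually_elim
    case (elim z)
    \<comment> \<open>Positivity of \<open>\<alpha>\<close> and \<open>s z\<close> removes the
      absolute value from the root of the square.\<close>
    have "sqrt (G z) = \<alpha> / s z" using elim \<open>\<alpha> > 0\<close> by (simp add: G_def)
    then show ?case
      using sq_hellinger_complete_square[of \<alpha> "L z" lam "g z"]
        sq_hellinger_complete_square[of \<alpha> "L z" lam "G z"] elim g(2)[of z] G0[of z]
      by (simp add: s_def)
  qed
  have meas: "?d \<in> borel_measurable P"
    using g(1) unfolding s_def by measurable
  show d: "integrable P ?d"
    using integrable_cong_AE[of ?h P ?d] h eq meas by auto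
  have "integral\<^sup>L P ?d = integral\<^sup>L P ?h"
    by (rule integral_cong_AE) (use h meas eq in auto)
  also have "\<dots> = (\<integral>z. g z * L z \<partial>P) + \<alpha> * (\<integral>z. sq_hellinger (g z) \<partial>P) + lam * (\<integral>z. g z \<partial>P)
     - ((\<integral>z. G z * L z \<partial>P) + \<alpha> * (\<integral>z. sq_hellinger (G z) \<partial>P) + lam * (\<integral>z. G z \<partial>P))"
    using int by simp
  \<comment> \<open>Equal masses make the two \<open>lam\<close> terms cancel.\<close>
  finally show "(\<integral>z. g z * L z \<partial>P) + \<alpha> * (\<integral>z. sq_hellinger (g z) \<partial>P)
      = (\<integral>z. G z * L z \<partial>P) + \<alpha> * (\<integral>z. sq_hellinger (G z) \<partial>P) + integral\<^sup>L P ?d"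
    using mass by simp
qed

section \<open>Existence and uniqueness of the minimizer\<close>

theorem mainTheorem7:
  fixes P :: "'a measure" and \<alpha> :: real and l :: "'a \<Rightarrow> ereal" and lam :: real
  assumes "prob_space P"
    and "\<alpha> > 0"
    and "l \<in> borel_measurable P"
    and "\<And>z. z \<in> space P \<Longrightarrow> l z > -\<infinity>"
    and "(\<integral>\<^sup>+ z. e2ennreal \<bar>l z\<bar> \<partial>P) < \<infinity>"
    and "\<exists>b::real. AE z in P. ereal b \<le> l z"
    and "AE z in P. ereal \<alpha> + l z + ereal lam > 0"
    and "ext_integral P (\<lambda>z. (ereal \<alpha> / (ereal \<alpha> + l z + ereal lam))\<^sup>2) = 1"
  shows "\<exists>Qs \<in> prob_measures_on P.
           absolutely_continuous P Qs \<and>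
           (AE z in P. RN_deriv P Qs z = e2ennreal ((ereal \<alpha> / (ereal \<alpha> + l z + ereal lam))\<^sup>2)) \<and>
           (\<forall>Q. is_arg_min (penalized_objective sq_hellinger \<alpha> l P) (\<lambda>Q. Q \<in> prob_measures_on P) Q
                \<longleftrightarrow> Q = Qs)"
proof -
  interpret prob_space P by fact
  have fin: "finite_measure P" by unfold_locales
  note l[measurable] = assms(3)
  obtain b :: real where b: "AE z in P. ereal b \<le> l z" using assms(6) by blast
  \<comment> \<open>\<open>real_of_ereal\<close> sends infinite values to \<open>0\<close>; this
    affects only a \<open>P\<close>-null set, since the integral of the absolute value of
    \<open>l\<close> is finite.\<close>
  define L where "L z = real_of_ereal (l z)" for z
  define s where "s z = \<alpha> + L z + lam" for z
  define G where "G z = (\<alpha> / s z)\<^sup>2" for z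
  define Qs where "Qs = density P (\<lambda>z. ennreal (G z))"
  let ?J = "penalized_objective sq_hellinger \<alpha> l P"
  let ?R = "\<lambda>g. (\<integral>z. g z * L z \<partial>P) + \<alpha> * (\<integral>z. sq_hellinger (g z) \<partial>P)"
  have Lm[measurable]: "L \<in> borel_measurable P" unfolding L_def by measurable
  have sm[measurable]: "s \<in> borel_measurable P" unfolding s_def by measurable
  have Gm[measurable]: "G \<in> borel_measurable P" unfolding G_def by measurable
  have G0: "G z \<ge> 0" for z by (simp add: G_def)

  have "AE z in P. e2ennreal \<bar>l z\<bar> \<noteq> \<infinity>"
    by (rule nn_integral_PInf_AE) (use assms(5) in auto)
  then have lL: "AE z in P. l z = ereal (L z)"
    unfolding L_def
  proof eventually_elim
    case (elim z)
    then show ?case by (cases "l z") auto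
  qed
  have s0: "AE z in P. s z > 0"
    using assms(7) lL by eventually_elim (simp add: s_def)
  have G_eq: "AE z in P. (ereal \<alpha> / (ereal \<alpha> + l z + ereal lam))\<^sup>2 = ereal (G z)"
    using lL s0 by eventually_elim (simp add: G_def s_def power2_eq_square)
  have "(\<integral>\<^sup>+ z. e2ennreal ((ereal \<alpha> / (ereal \<alpha> + l z + ereal lam))\<^sup>2) \<partial>P) = (\<integral>\<^sup>+ z. ennreal (G z) \<partial>P)"
    by (rule nn_integral_cong_AE, use G_eq in eventually_elim, simp)
  \<comment> \<open>The integrand is nonnegative almost everywhere, so the subtracted part of the
    extended integral vanishes and the normalization becomes a statement about \<open>G\<close>
    alone.\<close>
  moreover have "(\<integral>\<^sup>+ z. e2ennreal (- (ereal \<alpha> / (ereal \<alpha> + l z + ereal lam))\<^sup>2) \<partial>P) = (\<integral>\<^sup>+ z. 0 \<partial>P)"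
    by (rule nn_integral_cong_AE, use G_eq in eventually_elim) (simp add: G0 ennreal_neg)
  ultimately have "enn2ereal (\<integral>\<^sup>+ z. ennreal (G z) \<partial>P) = 1"
    using assms(8) by (simp add: ext_integral_def zero_ennreal.rep_eq)
  then have G1: "(\<integral>\<^sup>+ z. ennreal (G z) \<partial>P) = 1"
    by (metis e2ennreal_enn2ereal one_ereal_def e2ennreal_ereal ennreal_1)
  then have Gi: "integrable P G"
    by (intro integrableI_nonneg) (auto simp: G0)
  have Gint: "(\<integral>z. G z \<partial>P) = 1"
    using integral_eq_nn_integral[of G P] G1 G0 by simp
  \<comment> \<open>Substituting \<open>L = s - \<alpha> - lam\<close> and using
    \<open>G * s = \<alpha>\<^sup>2 / s = \<alpha> * sqrt G\<close> writes \<open>G * L\<close> as a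
    combination of \<open>sqrt G\<close> and \<open>G\<close>, both integrable.\<close>
  have GL: "integrable P (\<lambda>z. G z * L z)"
  proof (rule integrable_cong_AE_imp)
    show "integrable P (\<lambda>z. \<alpha> * sqrt (G z) - (\<alpha> + lam) * G z)"
      using Gi integrable_sqrt[OF fin Gi G0] by simp
    show "AE z in P. \<alpha> * sqrt (G z) - (\<alpha> + lam) * G z = G z * L z"
      using s0
    proof eventually_elim
      case (elim z)
      have r: "sqrt (G z) = \<alpha> / s z" using elim \<open>\<alpha> > 0\<close> by (simp add: G_def)
      have L: "L z = s z - \<alpha> - lam" by (simp add: s_def)
      show ?case
        unfolding r L using elim by (simp add: G_def power2_eq_square field_simps)
    qed
  qed simp

  have Qs_prob: "Qs \<in> prob_measures_on P"
    unfolding prob_measures_on_def Qs_def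
    using G1 by (auto intro!: prob_spaceI simp: emeasure_density cong: nn_integral_cong)
  have Qs_ac: "absolutely_continuous P Qs"
    unfolding Qs_def by (rule absolutely_continuousI_density) simp
  have "AE z in P. ennreal (G z) = RN_deriv P Qs z"
    by (rule RN_deriv_unique) (simp_all add: Qs_def)
  with G_eq have Qs_RN:
    "AE z in P. RN_deriv P Qs z = e2ennreal ((ereal \<alpha> / (ereal \<alpha> + l z + ereal lam))\<^sup>2)"
    by eventually_elim simp
  have J_Qs: "?J Qs = ereal (?R G)"
    unfolding Qs_def by (rule penalized_objective_density[OF fin Lm lL Gi G0 GL])

  \<comment> \<open>A strict inequality against every competitor gives minimality and uniqueness
    together. Since \<open>?J Qs\<close> is real, only competitors with
    \<open>?J Q \<noteq> \<infinity>\<close> need work.\<close>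
  have less: "?J Qs < ?J Q" if Q: "Q \<in> prob_measures_on P" "Q \<noteq> Qs" for Q
  proof (cases "?J Q = \<infinity>")
    case True
    then show ?thesis by (simp add: J_Qs)
  next
    case False
    interpret Q: prob_space Q using Q by (simp add: prob_measures_on_def)
    have sets: "sets Q = sets P" using Q by (simp add: prob_measures_on_def)
    have ac: "absolutely_continuous P Q"
      using False penalized_objective_not_ac \<open>\<alpha> > 0\<close> by blast
    define g where "g z = enn2real (RN_deriv P Q z)" for z
    have g0: "g z \<ge> 0" for z by (simp add: g_def)
    have gm[measurable]: "g \<in> borel_measurable P" unfolding g_def by measurable
    \<comment> \<open>Finiteness of the derivative almost everywhere lets the real function
      \<open>g\<close> serve as a density of \<open>Q\<close>.\<close>
    have "AE z in P. RN_deriv P Q z \<noteq> \<infinity>"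
      by (rule RN_deriv_finite) (use ac sets Q.sigma_finite_measure_axioms in auto)
    then have "AE z in P. RN_deriv P Q z = ennreal (g z)"
      by eventually_elim (simp add: g_def less_top)
    then have "density P (RN_deriv P Q) = density P (\<lambda>z. ennreal (g z))"
      by (intro density_cong) auto
    then have Qg: "Q = density P (\<lambda>z. ennreal (g z))"
      using density_RN_deriv[OF ac sets] by simp
    have g1: "(\<integral>\<^sup>+ z. ennreal (g z) \<partial>P) = 1"
      using Q.emeasure_space_1 unfolding Qg
      by (simp add: emeasure_density cong: nn_integral_cong)
    then have gi: "integrable P g"
      by (intro integrableI_nonneg) (auto simp: g0)
    have gint: "(\<integral>z. g z \<partial>P) = 1"
      using integral_eq_nn_integral[of g P] g1 g0 by simp
    \<comment> \<open>In \<open>ereal\<close>, \<open>\<infinity>\<close> as first summand absorbs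
      any second one, even \<open>-\<infinity>\<close>, so it would make the objective
      infinite.\<close>
    have "ext_integral Q l \<noteq> \<infinity>"
      using False by (auto simp: penalized_objective_def)
    moreover have "AE z in Q. ereal b \<le> l z"
      using absolutely_continuous_AE[OF sets ac b] .
    moreover have "l \<in> borel_measurable Q"
      using l sets measurable_cong_sets by blast
    ultimately have "integrable Q L"
      unfolding L_def by (intro ext_integral_finiteD(1)) (use Q.finite_measure_axioms in auto)
    then have gL: "integrable P (\<lambda>z. g z * L z)"
      unfolding Qg by (simp add: integrable_density g0)
    have J_Q: "?J Q = ereal (?R g)"
      by (subst Qg, rule penalized_objective_density[OF fin Lm lL gi g0 gL])
    let ?d = "\<lambda>z. s z * (sqrt (g z) - \<alpha> / s z)\<^sup>2"
    \<comment> \<open>Both masses are \<open>1\<close>, so the equal-mass premise is discharged by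
      \<open>refl\<close>.\<close>
    note gap = sq_hellinger_density_gap[OF fin \<open>\<alpha> > 0\<close> Lm s0[unfolded s_def]
        Gi[unfolded G_def s_def] GL[unfolded G_def s_def] gi g0 gL,
        folded s_def G_def, unfolded gint Gint, OF refl]
    have d0: "AE z in P. 0 \<le> ?d z"
      using s0 by eventually_elim simp
    \<comment> \<open>A zero integral of the nonnegative \<open>?d\<close> forces
      \<open>?d = 0\<close> almost everywhere; as \<open>s > 0\<close>, this means
      \<open>sqrt g = \<alpha> / s\<close>. The densities then agree almost everywhere and
      \<open>Q = Qs\<close>.\<close>
    have "integral\<^sup>L P ?d \<noteq> 0"
    proof
      assume "integral\<^sup>L P ?d = 0"
      then have "AE z in P. ?d z = 0"
        using integral_nonneg_eq_0_iff_AE[OF gap(1) d0] by simp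
      with s0 have "AE z in P. g z = G z"
      proof eventually_elim
        case (elim z)
        then have "sqrt (g z) = \<alpha> / s z" by simp
        then show ?case
          unfolding G_def using g0[of z] by (metis real_sqrt_pow2)
      qed
      then have "Q = Qs"
        unfolding Qs_def by (subst Qg, intro density_cong) auto
      with Q show False by simp
    qed
    with integral_nonneg_AE[OF d0] have "integral\<^sup>L P ?d > 0" by simp
    then show ?thesis unfolding J_Q J_Qs using gap(2) by simp
  qed
  have "is_arg_min ?J (\<lambda>Q. Q \<in> prob_measures_on P) Q \<longleftrightarrow> Q = Qs" for Q
  proof
    assume "is_arg_min ?J (\<lambda>Q. Q \<in> prob_measures_on P) Q"
    then have "Q \<in> prob_measures_on P" "\<not> ?J Qs < ?J Q"
      using Qs_prob by (auto simp: is_arg_min_def)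
    then show "Q = Qs" using less by blast
  next
    assume Q: "Q = Qs"
    have "\<not> ?J Q' < ?J Qs" if "Q' \<in> prob_measures_on P" for Q'
      using less[OF that] by (cases "Q' = Qs") auto
    with Qs_prob show "is_arg_min ?J (\<lambda>Q. Q \<in> prob_measures_on P) Q"
      unfolding Q is_arg_min_def by blast
  qed
  then show ?thesis using Qs_prob Qs_ac Qs_RN by blast
qed

end
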